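(* Let $G=C(T_1,\ldots,T_g)$ be a unicyclic graph of order $n$ which has a perfect matching and such that $2$ is an eigenvalue of the Laplacian matrix $L(G)$. Then there exist a real number $r\neq 0$ and an eigenvector $X=(x_1,\ldots,x_n)^t$ of $L(G)$ corresponding to the eigenvalue $2$ such that $x_i\in\{-r,r\}$ for all $i=1,\ldots,n$.
   Context: All graphs are finite, undirected, with no loops or multiple edges. The Laplacian matrix of $G$ is $L(G)=D(G)-A(G)$, where $D(G)$ is the diagonal matrix of vertex degrees and $A(G)$ is the adjacency matrix. A unicyclic graph is a connected graph whose number of edges equals its number of vertices; it consists of a cycle $C_g$ with vertices $v_1,\ldots,v_g$ and, for each $i$, a rooted tree $T_i$ of order $n_i\ge 1$ with root $v_i$, where $V(T_i)\cap V(C_g)=\{v_i\}$ and $\sum_{i=1}^g n_i=n$. Such a graph is denoted by $C(T_1,\ldots,T_g)$; every unicyclic graph has this form. *)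

theory Defs
  imports
    "Graph_Theory.Pair_Digraph"
    "Graph_Theory.Digraph_Component"
    "Jordan_Normal_Form.Char_Poly"
begin

text \<open>
  Finite simple undirected graphs are represented by the locale \<^locale>\<open>pair_graph\<close>: finite,
  loop-free, symmetric digraphs whose arcs are ordered pairs. Every undirected edge therefore
  occurs as two arcs, and edges are counted as two-element vertex sets.
\<close>

definition edges :: "'a pair_pre_digraph \<Rightarrow> 'a set set" where
  "edges G = {{u, v} | u v. (u, v) \<in> parcs G}"

definition unicyclic :: "'a pair_pre_digraph \<Rightarrow> bool" where
  "unicyclic G \<longleftrightarrow> pair_graph G \<and> connected (with_proj G) \<and> card (edges G) = card (pverts G)"

definition perfect_matching :: "'a pair_pre_digraph \<Rightarrow> 'a set set \<Rightarrow> bool" where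
  "perfect_matching G M \<longleftrightarrow>
     M \<subseteq> edges G \<and> (\<forall>e\<in>M. \<forall>f\<in>M. e \<noteq> f \<longrightarrow> e \<inter> f = {}) \<and> \<Union>M = pverts G"

text \<open>
  The matrices below are meant for graphs with vertex set \<open>{0..<n}\<close>, so that vertex \<open>i\<close> labels
  row and column \<open>i\<close>. The degree of a vertex is its out-degree in the symmetric digraph.
\<close>

definition adjacency_matrix :: "nat pair_pre_digraph \<Rightarrow> real mat" where
  "adjacency_matrix G =
     mat (card (pverts G)) (card (pverts G)) (\<lambda>(i, j). if (i, j) \<in> parcs G then 1 else 0)"

definition degree_matrix :: "nat pair_pre_digraph \<Rightarrow> real mat" where
  "degree_matrix G =
     mat (card (pverts G)) (card (pverts G))
       (\<lambda>(i, j). if i = j then real (out_degree (with_proj G) i) else 0)"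

definition laplacian_matrix :: "nat pair_pre_digraph \<Rightarrow> real mat" where
  "laplacian_matrix G = degree_matrix G - adjacency_matrix G"

end

theory Submission
  imports Defs
begin

text \<open>
  Let \<open>\<sigma>\<close> be \<open>-1\<close> on the edges of a perfect matching and \<open>1\<close> on all other edges, and let \<open>N\<close> be
  the incidence matrix whose row for the edge \<open>{u, v}\<close>, \<open>u < v\<close>, has the entry \<open>1\<close> at \<open>u\<close> and
  \<open>-\<sigma>\<close> at \<open>v\<close>. As each vertex lies on exactly one matching edge, \<open>L - 2 I = N\<^sup>T diag(\<sigma>) N\<close>. A
  unicyclic graph has as many edges as vertices, so \<open>N\<close> is square, and if \<open>2\<close> is an eigenvalue of
  \<open>L\<close> then \<open>N\<close> is singular. A nonzero \<open>y\<close> with \<open>N y = 0\<close> satisfies \<open>y\<^sub>u = \<sigma> y\<^sub>v\<close> on every edge,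
  so \<open>\<bar>y\<bar>\<close> is constant by connectedness, and \<open>(L - 2 I) y = 0\<close>.
\<close>

definition matching_sign :: "'a set set \<Rightarrow> 'a \<Rightarrow> 'a \<Rightarrow> real" where
  "matching_sign M u v = (if {u, v} \<in> M then -1 else 1)"

text \<open>The vertex order serves only to select one orientation of every edge.\<close>

definition forward_arcs :: "'a::linorder pair_pre_digraph \<Rightarrow> ('a \<times> 'a) set" where
  "forward_arcs G = {(u, v) \<in> parcs G. u < v}"

text \<open>The enumeration \<open>a\<close> of arcs indexes the rows, and their number is fixed to
  \<open>n\<close> so that the matrix has a determinant.\<close>

definition signed_incidence_matrix ::
  "nat set set \<Rightarrow> nat \<Rightarrow> (nat \<Rightarrow> nat \<times> nat) \<Rightarrow> real mat" where
  "signed_incidence_matrix M n a =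
     mat n n (\<lambda>(k, i). of_bool (i = fst (a k))
       - matching_sign M (fst (a k)) (snd (a k)) * of_bool (i = snd (a k)))"

lemma matching_sign_square [simp]: "matching_sign M u v * matching_sign M u v = 1"
  by (simp add: matching_sign_def)

lemma abs_matching_sign [simp]: "\<bar>matching_sign M u v\<bar> = 1"
  by (simp add: matching_sign_def)

text \<open>In a symmetric digraph connectedness yields directed walks between any two vertices, and
  \<open>f\<close> is propagated along them.\<close>

lemma (in pair_sym_digraph) constant_on_connected:
  assumes "connected (with_proj G)"
    and step: "\<And>u v. (u, v) \<in> parcs G \<Longrightarrow> f u = f v"
    and "u \<in> pverts G" "v \<in> pverts G"
  shows "f u = f v"
proof -
  have "strongly_connected (with_proj G)"
    using assms(1) by (intro symmetric_connected_imp_strongly_connected sym_arcs)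
  then have "u \<rightarrow>\<^sup>*\<^bsub>with_proj G\<^esub> v"
    using assms(3,4) by (auto simp: strongly_connected_def)
  then show ?thesis
    by (induction rule: reachable_induct) (auto dest: step)
qed

text \<open>Without loops, exactly one of the two orientations of an edge is increasing.\<close>

lemma card_forward_arcs:
  assumes "pair_graph G"
  shows "card (forward_arcs G) = card (edges G)"
proof (rule bij_betw_same_card)
  interpret pair_graph G by fact
  show "bij_betw (\<lambda>(u, v). {u, v}) (forward_arcs G) (edges G)"
  proof (rule bij_betw_imageI)
    show "inj_on (\<lambda>(u, v). {u, v}) (forward_arcs G)"
      by (auto simp: inj_on_def forward_arcs_def doubleton_eq_iff)
    show "(\<lambda>(u, v). {u, v}) ` forward_arcs G = edges G"
    proof
      show "edges G \<subseteq> (\<lambda>(u, v). {u, v}) ` forward_arcs G"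
      proof
        fix e assume "e \<in> edges G"
        then obtain u v where e: "e = {u, v}" "(u, v) \<in> parcs G"
          by (auto simp: edges_def)
        have "(u, v) \<in> forward_arcs G \<or> (v, u) \<in> forward_arcs G"
          using e(2) arcs_symmetric[OF e(2)] no_loops'[OF e(2)]
          by (auto simp: forward_arcs_def)
        then show "e \<in> (\<lambda>(u, v). {u, v}) ` forward_arcs G"
          unfolding e(1) by (force simp: insert_commute)
      qed
    qed (auto simp: forward_arcs_def edges_def)
  qed
qed

text \<open>The arcs split into the increasing ones and their reversals. This turns sums over edges
  into sums over arcs, which can be grouped by tail to produce degrees.\<close>

lemma sum_parcs_eq_sum_forward_arcs:
  fixes h :: "'a::linorder \<Rightarrow> 'a \<Rightarrow> 'b::comm_monoid_add"
  assumes "pair_graph G"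
  shows "(\<Sum>(u, v)\<in>parcs G. h u v) = (\<Sum>(u, v)\<in>forward_arcs G. h u v + h v u)"
proof -
  interpret pair_graph G by fact
  have fin: "finite (forward_arcs G)"
    using pair_finite_arcs by (rule rev_finite_subset) (auto simp: forward_arcs_def)
  have split: "parcs G = forward_arcs G \<union> prod.swap ` forward_arcs G"
  proof
    show "parcs G \<subseteq> forward_arcs G \<union> prod.swap ` forward_arcs G"
    proof (rule subrelI)
      fix u v assume uv: "(u, v) \<in> parcs G"
      then have "(u, v) \<in> forward_arcs G \<or> (v, u) \<in> forward_arcs G"
        using arcs_symmetric[OF uv] no_loops'[OF uv] by (auto simp: forward_arcs_def)
      then show "(u, v) \<in> forward_arcs G \<union> prod.swap ` forward_arcs G"
        by force
    qed
  qed (auto simp: forward_arcs_def arcs_symmetric)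
  have disj: "forward_arcs G \<inter> prod.swap ` forward_arcs G = {}"
    by (auto simp: forward_arcs_def)
  show ?thesis
    unfolding split sum.union_disjoint[OF fin finite_imageI[OF fin] disj]
    by (simp add: sum.reindex sum.distrib[symmetric] case_prod_unfold)
qed

text \<open>Exactly one neighbour of \<open>i\<close> is its matching partner, and it contributes -1
  instead of 1. This is the source of the eigenvalue 2.\<close>

lemma perfect_matching_sum_sign:
  assumes "pair_graph G" and M: "perfect_matching G M" and i: "i \<in> pverts G"
  shows "(\<Sum>v | (i, v) \<in> parcs G. matching_sign M i v) = real (out_degree (with_proj G) i) - 2"
proof -
  interpret pair_graph G by fact
  let ?N = "{v. (i, v) \<in> parcs G}"
  have arcs: "out_arcs (with_proj G) i = Pair i ` ?N"
    by (auto simp: out_arcs_def)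
  have fin: "finite ?N"
    using pair_finite_verts by (rule rev_finite_subset) (auto dest: in_arcsD2)
  have deg: "out_degree (with_proj G) i = card ?N"
    unfolding out_degree_def arcs by (intro card_image) (auto simp: inj_on_def)
  have edge: "M \<subseteq> edges G" and cover: "\<Union>M = pverts G"
    using M by (simp_all add: perfect_matching_def)
  have disj: "e = f" if "e \<in> M" "f \<in> M" "x \<in> e" "x \<in> f" for e f x
    using M that unfolding perfect_matching_def by (metis IntI emptyE)
  have "i \<in> \<Union>M"
    using i cover by simp
  then obtain e where e: "e \<in> M" "i \<in> e"
    by (rule UnionE)
  then obtain u v where uv: "e = {u, v}" "(u, v) \<in> parcs G"
    using edge unfolding edges_def by blast
  \<comment> \<open>The partner \<open>j\<close> is the other end of \<open>e\<close>; the arc found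
    above may point either way.\<close>
  obtain j where j: "e = {i, j}" "(i, j) \<in> parcs G"
  proof (cases "i = u")
    case True
    with uv show ?thesis by (intro that[of v]) auto
  next
    case False
    with uv e(2) arcs_symmetric[OF uv(2)] show ?thesis by (intro that[of u]) auto
  qed
  have mate: "{i, v} \<in> M \<longleftrightarrow> v = j" if "v \<in> ?N" for v
  proof
    assume "{i, v} \<in> M"
    then have "{i, v} = {i, j}"
      using disj[of "{i, v}" e i] e j(1) by simp
    then show "v = j" by (auto simp: doubleton_eq_iff)
  qed (use e j in auto)
  have "(\<Sum>v\<in>?N. matching_sign M i v) = (\<Sum>v\<in>?N. 1 - (if v = j then 2 else 0))"
    by (intro sum.cong) (auto simp: matching_sign_def mate)
  also have "\<dots> = real (card ?N) - 2"
    using fin j(2) by (simp add: sum_subtractf)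
  finally show ?thesis by (simp add: deg)
qed

lemma laplacian_matrix_carrier:
  assumes "pverts G = {0..<n}"
  shows "laplacian_matrix G \<in> carrier_mat n n"
  using assms by (auto simp: laplacian_matrix_def degree_matrix_def adjacency_matrix_def)

text \<open>Since \<open>\<sigma>\<^sup>2 = 1\<close>, an edge contributes \<sigma> to the diagonal
  at both of its ends and -1 to its two off-diagonal positions. Summed over the edges at a vertex,
  the diagonal becomes the degree minus 2.\<close>

lemma laplacian_minus_two_factorization:
  assumes G: "pair_graph G" and verts: "pverts G = {0..<n}" and M: "perfect_matching G M"
    and a: "bij_betw a {0..<n} (forward_arcs G)"
  shows "char_matrix (laplacian_matrix G) 2 =
    (signed_incidence_matrix M n a)\<^sup>T *
      (mat_diag n (\<lambda>k. matching_sign M (fst (a k)) (snd (a k))) * signed_incidence_matrix M n a)"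
    (is "?L = ?N\<^sup>T * (?W * ?N)")
proof -
  interpret pair_graph G by fact
  have N: "?N \<in> carrier_mat n n"
    by (simp add: signed_incidence_matrix_def)
  have L: "?L \<in> carrier_mat n n"
    by (intro char_matrix_closed laplacian_matrix_carrier verts)
  show ?thesis
  proof (rule eq_matI)
    fix i j
    assume "i < dim_row (?N\<^sup>T * (?W * ?N))" "j < dim_col (?N\<^sup>T * (?W * ?N))"
    then have ij: "i < n" "j < n"
      using N by auto
    let ?s = "matching_sign M"
    \<comment> \<open>The contribution \<open>p\<close> of an edge is shared between its two arcs:
      \<open>h\<close> holds the diagonal term at the tail and the off-diagonal term at
      \<open>(u, v)\<close>.\<close>
    define h where "h u v = ?s u v * of_bool (i = u \<and> j = u) - of_bool (i = u \<and> j = v)" for u v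
    define p where "p u v = ?s u v * ((of_bool (i = u) - ?s u v * of_bool (i = v)) *
      (of_bool (j = u) - ?s u v * of_bool (j = v)))" for u v
    have p_eq: "p u v = h u v + h v u" for u v
      by (auto simp: p_def h_def matching_sign_def insert_commute)
    have "(?N\<^sup>T * (?W * ?N)) $$ (i, j) = (\<Sum>k = 0..<n. p (fst (a k)) (snd (a k)))"
    proof -
      have "(?N\<^sup>T * (?W * ?N)) $$ (i, j) =
          (\<Sum>k = 0..<n. ?N $$ (k, i) * (?s (fst (a k)) (snd (a k)) * ?N $$ (k, j)))"
        unfolding mat_diag_mult_left[OF N] using ij N by (simp add: scalar_prod_def)
      also have "\<dots> = (\<Sum>k = 0..<n. p (fst (a k)) (snd (a k)))"
        using ij by (intro sum.cong) (simp_all add: signed_incidence_matrix_def p_def)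
      finally show ?thesis .
    qed
    also have "\<dots> = (\<Sum>(u, v)\<in>forward_arcs G. p u v)"
      using sum.reindex_bij_betw[OF a, of "\<lambda>(u, v). p u v"] by (simp add: case_prod_unfold)
    also have "\<dots> = (\<Sum>(u, v)\<in>parcs G. h u v)"
      unfolding p_eq sum_parcs_eq_sum_forward_arcs[OF G] ..
    also have "\<dots> = (\<Sum>(u, v)\<in>parcs G. of_bool (i = u \<and> j = u) * ?s u v)
        - (\<Sum>e\<in>parcs G. of_bool (e = (i, j)))"
      unfolding sum_subtractf[symmetric]
      by (rule sum.cong[OF refl]) (simp add: h_def case_prod_unfold prod_eq_iff eq_commute)
    also have "(\<Sum>e\<in>parcs G. of_bool (e = (i, j))) = (of_bool ((i, j) \<in> parcs G) :: real)"
      using pair_finite_arcs by (simp add: of_bool_def)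
    also have "(\<Sum>(u, v)\<in>parcs G. of_bool (i = u \<and> j = u) * ?s u v)
        = of_bool (i = j) * (\<Sum>v | (i, v) \<in> parcs G. ?s i v)"
    proof -
      have "(\<Sum>(u, v)\<in>parcs G. of_bool (i = u \<and> j = u) * ?s u v)
          = (\<Sum>(u, v)\<in>Pair i ` {v. (i, v) \<in> parcs G}. of_bool (i = j) * ?s u v)"
        using pair_finite_arcs by (intro sum.mono_neutral_cong_right) auto
      also have "\<dots> = of_bool (i = j) * (\<Sum>v | (i, v) \<in> parcs G. ?s i v)"
        by (subst sum.reindex) (auto simp: inj_on_def sum_distrib_left)
      finally show ?thesis .
    qed
    also have "(\<Sum>v | (i, v) \<in> parcs G. ?s i v) = real (out_degree (with_proj G) i) - 2"
      using ij verts by (intro perfect_matching_sum_sign[OF G M]) auto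
    also have "of_bool (i = j) * (real (out_degree (with_proj G) i) - 2)
        - of_bool ((i, j) \<in> parcs G) = ?L $$ (i, j)"
      using ij verts
      by (auto simp: char_matrix_def laplacian_matrix_def degree_matrix_def adjacency_matrix_def)
    finally show "?L $$ (i, j) = (?N\<^sup>T * (?W * ?N)) $$ (i, j)" ..
  next
    show "dim_row ?L = dim_row (?N\<^sup>T * (?W * ?N))"
      using carrier_matD[OF L] carrier_matD[OF N] by simp
    show "dim_col ?L = dim_col (?N\<^sup>T * (?W * ?N))"
      using carrier_matD[OF L] carrier_matD[OF N] by simp
  qed
qed

lemma signed_incidence_kernel:
  assumes y: "y \<in> carrier_vec n" and k: "k < n"
    and a: "fst (a k) < n" "snd (a k) < n"
    and "signed_incidence_matrix M n a *\<^sub>v y = 0\<^sub>v n"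
  shows "y $ fst (a k) = matching_sign M (fst (a k)) (snd (a k)) * y $ snd (a k)"
proof -
  let ?s = "matching_sign M (fst (a k)) (snd (a k))"
  have "0 = (signed_incidence_matrix M n a *\<^sub>v y) $ k"
    using assms by simp
  also have "\<dots> = (\<Sum>i = 0..<n. (if i = fst (a k) then y $ i else 0)
      - ?s * (if i = snd (a k) then y $ i else 0))"
    using y k
    by (auto simp: signed_incidence_matrix_def scalar_prod_def algebra_simps intro!: sum.cong)
  also have "\<dots> = y $ fst (a k) - ?s * y $ snd (a k)"
    using a by (simp add: sum_subtractf sum_distrib_left[symmetric])
  finally show ?thesis by simp
qed

theorem theorem5:
  fixes G :: "nat pair_pre_digraph" and n :: nat
  assumes "pverts G = {0..<n}"
    and "unicyclic G"
    and "\<exists>M. perfect_matching G M"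
    and "eigenvalue (laplacian_matrix G) 2"
  shows "\<exists>(r::real) X. r \<noteq> 0 \<and> eigenvector (laplacian_matrix G) X 2 \<and> (\<forall>i<n. X $ i \<in> {-r, r})"
proof -
  have G: "pair_graph G" and conn: "connected (with_proj G)"
    and card_eq: "card (edges G) = card (pverts G)"
    using assms(2) by (auto simp: unicyclic_def)
  interpret pair_graph G by (rule G)
  obtain M where M: "perfect_matching G M"
    using assms(3) by blast
  have fin: "finite (forward_arcs G)"
    using pair_finite_arcs by (rule rev_finite_subset) (auto simp: forward_arcs_def)
  \<comment> \<open>Unicyclicity enters here, beyond connectedness: it makes the incidence matrix
    square.\<close>
  have "card (forward_arcs G) = n"
    using card_forward_arcs[OF G] card_eq assms(1) by simp
  then obtain a where a: "bij_betw a {0..<n} (forward_arcs G)"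
    using ex_bij_betw_nat_finite[OF fin] by auto
  define N where "N = signed_incidence_matrix M n a"
  define W where "W = mat_diag n (\<lambda>k. matching_sign M (fst (a k)) (snd (a k)))"
  have N: "N \<in> carrier_mat n n" and W: "W \<in> carrier_mat n n"
    by (simp_all add: N_def signed_incidence_matrix_def W_def)
  have L: "laplacian_matrix G \<in> carrier_mat n n"
    by (rule laplacian_matrix_carrier) (rule assms(1))
  have fact: "char_matrix (laplacian_matrix G) 2 = N\<^sup>T * (W * N)"
    unfolding N_def W_def by (rule laplacian_minus_two_factorization[OF G assms(1) M a])
  have "det N * (det W * det N) = 0"
    using assms(4) N W by (simp add: eigenvalue_det[OF L] fact det_mult[of _ n] det_transpose)
  \<comment> \<open>Signs square to 1, so \<open>det W\<close> is nonzero and can be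
    cancelled.\<close>
  moreover have "W * W = 1\<^sub>m n"
    by (simp add: W_def)
  then have "det W * det W = 1"
    using W by (metis det_mult det_one)
  ultimately have "det N = 0"
    by auto
  then obtain y where y: "y \<in> carrier_vec n" "y \<noteq> 0\<^sub>v n" "N *\<^sub>v y = 0\<^sub>v n"
    using det_0_iff_vec_prod_zero[OF N] by blast
  have mult_zero: "A *\<^sub>v 0\<^sub>v n = 0\<^sub>v n" if "A \<in> carrier_mat n n" for A :: "real mat"
    using that by auto
  \<comment> \<open>The vector \<open>y\<close> is built from the kernel of \<open>N\<close>, not
    from a given eigenvector, which might have the wrong form: on the 4-cycle, (1, 0, -1, 0) also
    belongs to the eigenvalue 2.\<close>
  have ev: "eigenvector (laplacian_matrix G) y 2"
    unfolding eigenvector_char_matrix[OF L] fact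
    using y N W by (simp add: assoc_mult_mat_vec[of _ n n _ n] mult_zero)
  have fwd: "\<bar>y $ u\<bar> = \<bar>y $ v\<bar>" if "(u, v) \<in> forward_arcs G" for u v
  proof -
    have "(u, v) \<in> a ` {0..<n}"
      unfolding bij_betw_imp_surj_on[OF a] by (rule that)
    then obtain k where k: "k < n" "a k = (u, v)"
      by (elim imageE) simp
    have "u < n" "v < n"
      using that in_arcsD1[of u v] in_arcsD2[of u v] assms(1) by (auto simp: forward_arcs_def)
    then show ?thesis
      using signed_incidence_kernel[of y n k a M] y k by (simp add: N_def abs_mult)
  qed
  have "\<bar>y $ u\<bar> = \<bar>y $ v\<bar>" if "(u, v) \<in> parcs G" for u v
    using fwd[of u v] fwd[of v u] that arcs_symmetric[OF that] no_loops'[OF that]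
    by (cases u v rule: linorder_cases) (auto simp: forward_arcs_def)
  then have const: "\<bar>y $ u\<bar> = \<bar>y $ v\<bar>" if "u < n" "v < n" for u v
    by (rule constant_on_connected[OF conn]) (use that assms(1) in auto)
  \<comment> \<open>Any nonzero entry of \<open>y\<close> can serve as \<open>r\<close>, whatever
    its sign.\<close>
  obtain i where i: "i < n" "y $ i \<noteq> 0"
    using y(1,2) by (metis carrier_vecD eq_vecI index_zero_vec)
  have "\<forall>j<n. y $ j \<in> {- y $ i, y $ i}"
    using const[OF _ i(1)] unfolding abs_eq_iff by blast
  with i(2) ev show ?thesis
    by blast
qed

end
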